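(* Fix $\lambda>0$ and $z>0$. The filtration $\mathbb{F}^{\xi^{\lambda,z},c}$ satisfies the usual conditions of right-continuity and completeness.
   Context: Let $B=(B_t)_{t\ge 0}$ be a standard Brownian motion started at $0$ on a complete probability space $(\Omega,\mathcal{F},\mathbb{P})$, with $\mathcal{N}_{\mathbb{P}}$ the collection of $\mathbb{P}$-null sets. For $\lambda>0$, $z>0$, put $B^\lambda_t=B_t+\lambda t$, $\sigma_z^\lambda=\sup\{t>0: B^\lambda_t=z\}$ (almost surely finite), and $\xi^{\lambda,z}_t=B^\lambda_{t\wedge\sigma_z^\lambda}$, $t\ge 0$. The completed natural filtration is $\mathbb{F}^{\xi^{\lambda,z},c}=(\mathcal{F}^{\xi^{\lambda,z},c}_t)_{t\ge0}$ with $\mathcal{F}^{\xi^{\lambda,z},c}_t=\sigma(\xi^{\lambda,z}_s,\,s\le t)\vee\mathcal{N}_{\mathbb{P}}$. *)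

theory Defs
  imports "HOL-Probability.Probability"
begin

text \<open>
  All processes and filtrations are indexed by the type \<^typ>\<open>real\<close>, but only the
  times \<open>t \<ge> 0\<close> carry meaning. The starting value and the continuity of paths are
  required almost surely only.
\<close>

definition standard_brownian_motion :: "'a measure \<Rightarrow> (real \<Rightarrow> 'a \<Rightarrow> real) \<Rightarrow> bool" where
  "standard_brownian_motion M B \<longleftrightarrow>
     prob_space M \<and>
     (\<forall>t\<ge>0. B t \<in> borel_measurable M) \<and>
     (AE \<omega> in M. B 0 \<omega> = 0) \<and>
     (AE \<omega> in M. continuous_on {0..} (\<lambda>t. B t \<omega>)) \<and>
     (\<forall>s t. 0 \<le> s \<and> s < t \<longrightarrow>
        distributed M lborel (\<lambda>\<omega>. B t \<omega> - B s \<omega>) (normal_density 0 (sqrt (t - s)))) \<and>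
     (\<forall>(n::nat) (t::nat \<Rightarrow> real). 0 \<le> t 0 \<and> (\<forall>i<n. t i < t (Suc i)) \<longrightarrow>
        prob_space.indep_vars M (\<lambda>_. borel) (\<lambda>i \<omega>. B (t (Suc i)) \<omega> - B (t i) \<omega>) {..<n})"

definition drifted :: "(real \<Rightarrow> 'a \<Rightarrow> real) \<Rightarrow> real \<Rightarrow> real \<Rightarrow> 'a \<Rightarrow> real" where
  "drifted B lam t \<omega> = B t \<omega> + lam * t"

text \<open>
  The last passage time takes values in \<open>[0,\<infinity>]\<close>: it is \<open>0\<close> if the level is never attained
  at a positive time, and \<open>\<infinity>\<close> if it is attained at arbitrarily large times.
\<close>

definition last_passage_time :: "(real \<Rightarrow> 'a \<Rightarrow> real) \<Rightarrow> real \<Rightarrow> 'a \<Rightarrow> ennreal" where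
  "last_passage_time X z \<omega> = Sup {ennreal t | t. t > 0 \<and> X t \<omega> = z}"

text \<open>The minimum below is at most \<open>t\<close>, hence finite, so \<^const>\<open>enn2real\<close> loses nothing.\<close>

definition stopped_process ::
  "(real \<Rightarrow> 'a \<Rightarrow> real) \<Rightarrow> ('a \<Rightarrow> ennreal) \<Rightarrow> real \<Rightarrow> 'a \<Rightarrow> real" where
  "stopped_process X T t \<omega> = X (enn2real (min (ennreal t) (T \<omega>))) \<omega>"

definition last_passage_stopped_bm :: 
  "(real \<Rightarrow> 'a \<Rightarrow> real) \<Rightarrow> real \<Rightarrow> real \<Rightarrow> real \<Rightarrow> 'a \<Rightarrow> real" where
  "last_passage_stopped_bm B lam z =
     stopped_process (drifted B lam) (last_passage_time (drifted B lam) z)"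

text \<open>
  On a complete measure space, \<^term>\<open>null_sets M\<close> contains every subset of a set of measure zero.
  The measure carried by the \<open>\<sigma>\<close>-algebras below is irrelevant; only \<^const>\<open>space\<close> and
  \<^const>\<open>sets\<close> matter.
\<close>

definition completed_natural_filtration ::
  "'a measure \<Rightarrow> (real \<Rightarrow> 'a \<Rightarrow> real) \<Rightarrow> real \<Rightarrow> 'a measure" where
  "completed_natural_filtration M X t =
     sigma (space M)
       ({X s -` A \<inter> space M | s A. 0 \<le> s \<and> s \<le> t \<and> A \<in> sets borel} \<union> null_sets M)"

definition filtration_on :: "'a measure \<Rightarrow> (real \<Rightarrow> 'a measure) \<Rightarrow> bool" where
  "filtration_on M F \<longleftrightarrow>
     (\<forall>t\<ge>0. subalgebra M (F t)) \<and>
     (\<forall>s t. 0 \<le> s \<and> s \<le> t \<longrightarrow> sets (F s) \<subseteq> sets (F t))"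

definition right_continuous_filtration :: "(real \<Rightarrow> 'a measure) \<Rightarrow> bool" where
  "right_continuous_filtration F \<longleftrightarrow> (\<forall>t\<ge>0. sets (F t) = (\<Inter>u\<in>{t<..}. sets (F u)))"

definition complete_filtration :: "'a measure \<Rightarrow> (real \<Rightarrow> 'a measure) \<Rightarrow> bool" where
  "complete_filtration M F \<longleftrightarrow>
     complete_measure M \<and> (\<forall>t\<ge>0. null_sets M \<subseteq> sets (F t))"

definition usual_conditions :: "'a measure \<Rightarrow> (real \<Rightarrow> 'a measure) \<Rightarrow> bool" where
  "usual_conditions M F \<longleftrightarrow>
     filtration_on M F \<and> right_continuous_filtration F \<and> complete_filtration M F"

end

theory Submission
  imports Defs
begin

text \<open>
  Write \<open>X\<close> for the drifted motion, \<open>T\<close> for its last passage time at \<open>z\<close> and \<open>\<xi>\<close> for the stopped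
  process. Almost surely \<open>T > 0\<close>, \<open>\<xi>\<^sub>t = z\<close> on \<open>{T \<le> t}\<close>, and \<open>\<xi>\<^sub>t = X\<^sub>t \<noteq> z\<close> on \<open>{t < T}\<close>; hence
  \<open>{t < T}\<close> is observable from \<open>\<xi>\<^sub>t\<close>. On \<open>{T \<le> t}\<close> the process \<open>\<xi>\<close> is constant after \<open>t\<close>, so all
  later \<open>\<sigma>\<close>-algebras have the same trace as the one at time \<open>t\<close>. On \<open>{u < T}\<close> the filtration of \<open>\<xi>\<close>
  at time \<open>u\<close> has the same trace as the Brownian one, so right-continuity on \<open>{t < T}\<close> is inherited
  from the completed Brownian filtration. For the latter, the increments strictly after \<open>t\<close> are
  independent of the germ \<open>\<sigma>\<close>-algebra at \<open>t+\<close> and, by continuity, generate the future together with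
  the \<open>\<sigma>\<close>-algebra at \<open>t\<close>.
\<close>

subsection \<open>Sub-\<open>\<sigma>\<close>-algebras up to null sets\<close>

text \<open>Agreement on \<open>P\<close> off a null set with some member of \<open>N\<close>
  survives complements and countable unions, so it passes from generators to the whole
  \<sigma>-algebra. Stating it as an implication compares traces on an event without intersecting
  with it.\<close>

lemma sigma_sets_AE_trace:
  assumes A: "A \<in> sigma_sets (space M) G"
    and N: "sigma_algebra (space M) N"
    and gen: "\<And>g. g \<in> G \<Longrightarrow> \<exists>h\<in>N. AE \<omega> in M. P \<omega> \<longrightarrow> (\<omega> \<in> g \<longleftrightarrow> \<omega> \<in> h)"
  shows "\<exists>h\<in>N. AE \<omega> in M. P \<omega> \<longrightarrow> (\<omega> \<in> A \<longleftrightarrow> \<omega> \<in> h)"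
proof -
  interpret N: sigma_algebra "space M" N by fact
  from A show ?thesis
  proof induction
    case (Basic a)
    then show ?case by (rule gen)
  next
    case Empty
    show ?case by (intro bexI[of _ "{}"]) auto
  next
    case (Compl a)
    then obtain h where "h \<in> N" and ae: "AE \<omega> in M. P \<omega> \<longrightarrow> (\<omega> \<in> a \<longleftrightarrow> \<omega> \<in> h)" by blast
    show ?case
      using ae \<open>h \<in> N\<close> by (intro bexI[of _ "space M - h"]) auto
  next
    case (Union a)
    then have "\<forall>i. \<exists>h\<in>N. AE \<omega> in M. P \<omega> \<longrightarrow> (\<omega> \<in> a i \<longleftrightarrow> \<omega> \<in> h)" by blast
    then obtain h where h: "\<And>i. h i \<in> N"
      and ae: "\<And>i. AE \<omega> in M. P \<omega> \<longrightarrow> (\<omega> \<in> a i \<longleftrightarrow> \<omega> \<in> h i)" by metis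
    have "AE \<omega> in M. \<forall>i::nat. P \<omega> \<longrightarrow> (\<omega> \<in> a i \<longleftrightarrow> \<omega> \<in> h i)"
      using ae by (subst AE_all_countable) blast
    then show ?case
      using h by (intro bexI[of _ "\<Union>i. h i"]) auto
  qed
qed

text \<open>By completeness \<open>A - B\<close> and \<open>B - A\<close> are null sets, hence lie
  in \<open>N\<close>, and \<open>A\<close> is obtained from \<open>B\<close> by adding one and
  removing the other.\<close>

lemma (in complete_measure) in_subalgebra_AE:
  assumes N: "subalgebra M N" and null: "null_sets M \<subseteq> sets N"
    and ae: "AE x in M. x \<in> A \<longleftrightarrow> x \<in> B" and B: "B \<in> sets N" and A: "A \<subseteq> space M"
  shows "A \<in> sets N"
proof -
  have "B \<subseteq> space M" using N B sets.sets_into_space[of B N] by (simp add: subalgebra_def)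
  have "(AE x in M. x \<notin> B - A \<and> x \<notin> A - B)"
    using ae by eventually_elim auto
  then have "B - A \<in> sets N" "A - B \<in> sets N"
    using A \<open>B \<subseteq> space M\<close> null unfolding null_sets_iff_AE
    by (auto intro!: subsetD[OF null] simp: null_sets_iff_AE)
  then have "B \<union> (A - B) - (B - A) \<in> sets N"
    using B by blast
  also have "B \<union> (A - B) - (B - A) = A" by auto
  finally show ?thesis .
qed

lemma (in complete_measure) measurable_subalgebra_AE:
  assumes N: "subalgebra M N" and null: "null_sets M \<subseteq> sets N"
    and f: "f \<in> N \<rightarrow>\<^sub>M S" and ae: "AE x in M. f x = g x"
    and g: "\<And>x. x \<in> space M \<Longrightarrow> g x \<in> space S"
  shows "g \<in> N \<rightarrow>\<^sub>M S"
proof (rule measurableI)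
  have sp: "space N = space M" using N by (simp add: subalgebra_def)
  show "g x \<in> space S" if "x \<in> space N" for x using that g by (simp add: sp)
  fix E assume "E \<in> sets S"
  then have "f -` E \<inter> space N \<in> sets N" using f by (rule measurable_sets[rotated])
  then show "g -` E \<inter> space N \<in> sets N"
    by (rule in_subalgebra_AE[OF N null, rotated]) (use ae in \<open>auto simp: sp\<close>)
qed

section \<open>Independence and conditional expectation modulo null sets\<close>

context prob_space
begin

text \<open>Probabilities of intersections do not see null sets. This carries independence from a
  generated \<sigma>-algebra to its completion.\<close>

lemma indep_set_AE_cong:
  assumes indep: "indep_set \<A> \<B>" and ev: "\<A>' \<subseteq> events"
    and ae: "\<And>a. a \<in> \<A>' \<Longrightarrow> \<exists>h\<in>\<A>. AE \<omega> in M. \<omega> \<in> a \<longleftrightarrow> \<omega> \<in> h"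
  shows "indep_set \<A>' \<B>"
proof (rule indep_setI)
  show "\<A>' \<subseteq> events" by fact
  show B: "\<B> \<subseteq> events" using indep by (rule indep_setD_ev2)
  fix a b assume a: "a \<in> \<A>'" and b: "b \<in> \<B>"
  from ae[OF a] obtain h where h: "h \<in> \<A>" and ah: "AE \<omega> in M. \<omega> \<in> a \<longleftrightarrow> \<omega> \<in> h" by blast
  have [measurable]: "a \<in> events" "b \<in> events" "h \<in> events"
    using a ev b B h indep_setD_ev1[OF indep] by auto
  have "prob (a \<inter> b) = prob (h \<inter> b)"
    by (rule finite_measure_eq_AE) (use ah in auto)
  also have "\<dots> = prob h * prob b" by (rule indep_setD[OF indep h b])
  also have "prob h = prob a" by (rule finite_measure_eq_AE) (use ah in auto)
  finally show "prob (a \<inter> b) = prob a * prob b" .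
qed

text \<open>
  Conditioning on \<open>A\<close> and enlarging by events independent of \<open>\<H>\<close> cannot produce new
  information about \<open>\<H>\<close>: \<open>P(H | A)\<close> and \<open>1\<^sub>H\<close> have equal integrals over all
  \<open>D \<inter> g\<close>, hence over \<open>H\<close> itself and its complement.
\<close>

lemma indep_enlargement_trivial:
  assumes sub: "subalgebra M A" and AH: "sets A \<subseteq> \<H>"
    and indep: "indep_set \<H> \<G>" and stab: "Int_stable \<H>" "Int_stable \<G>"
    and G1: "space M \<in> \<G>"
    and H: "H \<in> \<H>" "H \<in> sigma_sets (space M) (sets A \<union> \<G>)"
  shows "\<exists>a\<in>sets A. AE \<omega> in M. \<omega> \<in> H \<longleftrightarrow> \<omega> \<in> a"
proof -
  interpret A: finite_measure_subalgebra M A by standard fact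
  define Y where "Y = real_cond_exp M A (indicator H)"
  \<comment> \<open>The goal is \<open>f\<close> = 0 almost surely. The sets in \<open>P\<close>
    form a \<pi>-system generating the enlarged \<sigma>-algebra, so the integrals of
    \<open>f\<close> are tested on them first.\<close>
  define f where "f \<omega> = indicator H \<omega> - Y \<omega>" for \<omega>
  define P where "P = {D \<inter> g | D g. D \<in> sets A \<and> g \<in> \<G>}"
  have spA: "space A = space M" and AM: "sets A \<subseteq> events"
    using sub by (auto simp: subalgebra_def)
  have GM: "\<G> \<subseteq> events" using indep by (rule indep_setD_ev2)
  have HM: "\<H> \<subseteq> events" using indep by (rule indep_setD_ev1)
  have [measurable]: "H \<in> events" using H HM by auto
  have Ym: "Y \<in> borel_measurable A" unfolding Y_def by simp
  have [measurable]: "Y \<in> borel_measurable M" unfolding Y_def by simp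
  have int_H: "integrable M (indicator H :: _ \<Rightarrow> real)" by (simp add: emeasure_eq_measure)
  have int_Y: "integrable M Y" unfolding Y_def by (rule A.real_cond_exp_int(1)[OF int_H])
  have int_f: "integrable M f" unfolding f_def using int_H int_Y by simp
  have int_fC: "integrable M (\<lambda>\<omega>. indicator C \<omega> * f \<omega>)" if "C \<in> events" for C
    using integrable_mult_indicator[OF that int_f] by simp
  \<comment> \<open>Both integrals, of \<open>Y\<close> and of the indicator of \<open>H\<close>,
    equal \<open>prob (H \<inter> D) * prob g\<close>: the first by conditioning \<open>g\<close> on
    \<open>A\<close>, the second because \<open>H \<inter> D\<close> lies in
    \<open>\<H>\<close>.\<close>
  have D_inter_g: "(\<integral>\<omega>. indicator (D \<inter> g) \<omega> * f \<omega> \<partial>M) = 0" if D: "D \<in> sets A" and g: "g \<in> \<G>" for D g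
  proof -
    have [measurable]: "D \<in> events" "g \<in> events" using D g AM GM by auto
    have HD: "H \<inter> D \<in> \<H>" using Int_stableD[OF stab(1) H(1), of D] D AH by blast
    have DA[measurable]: "D \<in> sets A" by fact
    have Ym'[measurable]: "Y \<in> borel_measurable A" by fact
    have int1: "integrable M (\<lambda>\<omega>. indicator D \<omega> * Y \<omega>)"
      using integrable_mult_indicator[of D M Y] int_Y by simp
    have int2: "integrable M (\<lambda>\<omega>. indicator D \<omega> * Y \<omega> * indicator g \<omega>)"
      using integrable_mult_indicator[OF _ int1, of g] by (simp add: mult.commute)
    have int_g: "integrable M (indicator g :: _ \<Rightarrow> real)" by (simp add: emeasure_eq_measure)
    \<comment> \<open>Since \<open>sets A\<close> is contained in \<open>\<H>\<close>, it is
      independent of \<open>g\<close>, so conditioning on it leaves a constant.\<close>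
    have ce: "AE \<omega> in M. real_cond_exp M A (indicator g) \<omega> = prob g"
    proof (rule A.real_cond_exp_charact)
      fix E assume E: "E \<in> sets A"
      then have [measurable]: "E \<in> events" using AM by auto
      have "(\<integral>x\<in>E. indicator g x \<partial>M) = (\<integral>x. indicator (E \<inter> g) x \<partial>M)"
        unfolding set_lebesgue_integral_def by (intro Bochner_Integration.integral_cong) (auto simp: indicator_def)
      also have "\<dots> = prob (E \<inter> g)" by (simp add: Int_absorb2 sets.sets_into_space)
      also have "\<dots> = prob E * prob g" using E AH g by (intro indep_setD[OF indep]) auto
      also have "\<dots> = (\<integral>x\<in>E. prob g \<partial>M)"
        unfolding set_lebesgue_integral_def by (simp add: Int_absorb2 sets.sets_into_space)
      finally show "(\<integral>x\<in>E. indicator g x \<partial>M) = (\<integral>x\<in>E. prob g \<partial>M)" .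
    qed (use int_g in auto)
    have "(\<integral>\<omega>. indicator (D \<inter> g) \<omega> * Y \<omega> \<partial>M) = (\<integral>\<omega>. indicator D \<omega> * Y \<omega> * indicator g \<omega> \<partial>M)"
      by (intro Bochner_Integration.integral_cong) (auto simp: indicator_def)
    also have "\<dots> = (\<integral>\<omega>. indicator D \<omega> * Y \<omega> * real_cond_exp M A (indicator g) \<omega> \<partial>M)"
      by (rule A.real_cond_exp_intg(2)[symmetric]) (use int2 in measurable)
    also have "\<dots> = (\<integral>\<omega>. indicator D \<omega> * Y \<omega> * prob g \<partial>M)"
      by (rule integral_cong_AE) (use ce in auto)
    also have "\<dots> = (\<integral>\<omega>. indicator D \<omega> * Y \<omega> \<partial>M) * prob g" by simp
    also have "(\<integral>\<omega>. indicator D \<omega> * Y \<omega> \<partial>M) = (\<integral>\<omega>. indicator D \<omega> * indicator H \<omega> \<partial>M)"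
      unfolding Y_def
      by (rule A.real_cond_exp_intg(2)) (use integrable_mult_indicator[OF _ int_H, of D] in auto)
    also have "\<dots> = (\<integral>\<omega>. indicator (H \<inter> D) \<omega> \<partial>M)"
      by (intro Bochner_Integration.integral_cong) (auto simp: indicator_def)
    also have "\<dots> * prob g = prob (H \<inter> D) * prob g"
      by (simp add: Int_absorb2 sets.sets_into_space le_infI1)
    also have "\<dots> = prob (H \<inter> D \<inter> g)"
      by (rule indep_setD[OF indep HD g, symmetric])
    also have "\<dots> = (\<integral>\<omega>. indicator (H \<inter> D \<inter> g) \<omega> \<partial>M)"
      by (simp add: Int_absorb2 sets.sets_into_space le_infI1)
    also have "\<dots> = (\<integral>\<omega>. indicator (D \<inter> g) \<omega> * indicator H \<omega> \<partial>M)"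
      by (intro Bochner_Integration.integral_cong) (auto simp: indicator_def)
    finally have "(\<integral>\<omega>. indicator (D \<inter> g) \<omega> * Y \<omega> \<partial>M) = (\<integral>\<omega>. indicator (D \<inter> g) \<omega> * indicator H \<omega> \<partial>M)" .
    moreover have "integrable M (\<lambda>\<omega>. indicator (D \<inter> g) \<omega> * Y \<omega>)"
      using integrable_mult_indicator[of "D \<inter> g" M Y] int_Y by simp
    moreover have "integrable M (\<lambda>\<omega>. indicator (D \<inter> g) \<omega> * indicator H \<omega> :: real)"
      using integrable_mult_indicator[OF _ int_H, of "D \<inter> g"] by simp
    ultimately show ?thesis
      by (simp add: f_def right_diff_distrib)
  qed
  have "Int_stable P"
  proof (rule Int_stableI)
    fix a b assume "a \<in> P" "b \<in> P"
    then obtain D g D' g' where *: "a = D \<inter> g" "b = D' \<inter> g'" "D \<in> sets A" "D' \<in> sets A" "g \<in> \<G>" "g' \<in> \<G>"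
      by (auto simp: P_def)
    then have "a \<inter> b = (D \<inter> D') \<inter> (g \<inter> g')" "D \<inter> D' \<in> sets A" "g \<inter> g' \<in> \<G>"
      using stab(2) by (auto intro: Int_stableD)
    then show "a \<inter> b \<in> P" unfolding P_def by blast
  qed
  have PM: "P \<subseteq> events" using AM GM by (auto simp: P_def)
  have PP: "P \<subseteq> Pow (space M)" using PM sets.space_closed by blast
  interpret G: sigma_algebra "space M" "sigma_sets (space M) (sets A \<union> \<G>)"
    by (rule sigma_algebra_sigma_sets) (use AM GM sets.space_closed in blast)
  have gen: "sigma_sets (space M) (sets A \<union> \<G>) = sigma_sets (space M) P"
  proof (rule antisym)
    show "sigma_sets (space M) P \<subseteq> sigma_sets (space M) (sets A \<union> \<G>)"
    proof (rule sigma_sets_mono, rule subsetI)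
      fix x assume "x \<in> P"
      then obtain D g where "x = D \<inter> g" "D \<in> sets A" "g \<in> \<G>" by (auto simp: P_def)
      then show "x \<in> sigma_sets (space M) (sets A \<union> \<G>)"
        by (simp add: G.Int)
    qed
    have "sets A \<union> \<G> \<subseteq> P"
    proof safe
      fix x assume x: "x \<in> sets A"
      then have "x = x \<inter> space M" using spA sets.sets_into_space by blast
      then show "x \<in> P" using x G1 unfolding P_def by blast
    next
      fix x assume x: "x \<in> \<G>"
      then have "x = space M \<inter> x" using GM sets.sets_into_space by blast
      then show "x \<in> P" using x sets.top[of A] unfolding P_def spA by blast
    qed
    then show "sigma_sets (space M) (sets A \<union> \<G>) \<subseteq> sigma_sets (space M) P"
      by (rule sigma_sets_mono')
  qed
  \<comment> \<open>Dynkin's argument: vanishing integrals pass to complements and, by countable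
    additivity, to disjoint unions.\<close>
  have zero: "(\<integral>\<omega>. indicator C \<omega> * f \<omega> \<partial>M) = 0" if "C \<in> sigma_sets (space M) P" for C
    using \<open>Int_stable P\<close> PP that
  proof (induction rule: sigma_sets_induct_disjoint)
    case (basic a)
    then show ?case using D_inter_g by (auto simp: P_def simp del: indicator_inter_arith)
  next
    case empty
    show ?case by simp
  next
    case (compl a)
    then have a: "a \<in> events" using PM sets.sigma_sets_subset by blast
    have "(\<integral>\<omega>. indicator (space M) \<omega> * f \<omega> \<partial>M) = 0"
      using D_inter_g[of "space M" "space M"] sets.top[of A] G1 spA by simp
    moreover have "(\<integral>\<omega>. indicator (space M - a) \<omega> * f \<omega> \<partial>M)
        = (\<integral>\<omega>. indicator (space M) \<omega> * f \<omega> - indicator a \<omega> * f \<omega> \<partial>M)"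
      by (intro Bochner_Integration.integral_cong) (auto simp: indicator_def)
    ultimately show ?case
      using compl int_fC[OF a] int_fC[of "space M"] by simp
  next
    case (union a)
    then have a: "a i \<in> events" for i using PM sets.sigma_sets_subset by blast
    have "(\<integral>\<omega>\<in>(\<Union>i. a i). f \<omega> \<partial>M) = (\<Sum>i. \<integral>\<omega>\<in>a i. f \<omega> \<partial>M)"
    proof (rule lebesgue_integral_countable_add)
      show "a i \<inter> a j = {}" if "i \<noteq> j" for i j
        using union(1) that by (auto simp: disjoint_family_on_def)
      show "set_integrable M (\<Union>i. a i) f"
        unfolding set_integrable_def using int_fC[of "\<Union>i. a i"] a by auto
    qed (use a in auto)
    then show ?case using union(3) by (simp add: set_lebesgue_integral_def)
  qed
  \<comment> \<open>Here the second membership of \<open>H\<close> enters: it makes \<open>f\<close>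
    measurable for \<open>S\<close>, so the conditional expectation of \<open>f\<close> given
    \<open>S\<close> is both \<open>f\<close> and 0.\<close>
  define S where "S = sigma (space M) P"
  have setsS: "sets S = sigma_sets (space M) P" and spS: "space S = space M"
    using PP by (simp_all add: S_def)
  have subS: "subalgebra M S"
    unfolding subalgebra_def setsS spS using PM sets.sigma_sets_subset by blast
  interpret S: finite_measure_subalgebra M S by standard fact
  have "sets A \<subseteq> sets S" unfolding setsS gen[symmetric] by (auto intro: sigma_sets.Basic)
  then have "Y \<in> borel_measurable S"
    using Ym spS spA by (auto simp: measurable_def)
  moreover have "H \<in> sets S" using H(2) by (simp add: setsS gen)
  ultimately have fS: "f \<in> borel_measurable S"
    unfolding f_def by (intro borel_measurable_diff borel_measurable_indicator)
  have "AE \<omega> in M. real_cond_exp M S f \<omega> = 0"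
    by (rule S.real_cond_exp_charact)
      (use zero int_f in \<open>auto simp: setsS set_lebesgue_integral_def\<close>)
  moreover have "AE \<omega> in M. real_cond_exp M S f \<omega> = f \<omega>"
    by (rule S.real_cond_exp_F_meas[OF int_f fS])
  ultimately have "AE \<omega> in M. f \<omega> = 0" by eventually_elim simp
  \<comment> \<open>\<open>Y\<close> is now a version of the indicator of \<open>H\<close>, so its
    level set at 1 is the required member of \<open>A\<close>.\<close>
  then have "AE \<omega> in M. \<omega> \<in> H \<longleftrightarrow> \<omega> \<in> Y -` {1} \<inter> space A"
    using AE_space by eventually_elim (auto simp: f_def spA indicator_def split: if_splits)
  moreover have "Y -` {1} \<inter> space A \<in> sets A"
    using Ym by (rule measurable_sets) simp
  ultimately show ?thesis by blast
qed

end

subsection \<open>Independence of the Brownian past and future\<close>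

text \<open>With base \<open>a\<close> = 0 and times up to \<open>u\<close> this encodes the
  Brownian past, with base \<open>u\<close> and times from \<open>u\<close> on the future. A single
  base point keeps the generators indexed by one time.\<close>

definition increments_algebra :: "'a measure \<Rightarrow> (real \<Rightarrow> 'a \<Rightarrow> real) \<Rightarrow> real \<Rightarrow> real set \<Rightarrow> 'a set set" where
  "increments_algebra M B a T =
     sigma_sets (space M) {(\<lambda>\<omega>. B r \<omega> - B a \<omega>) -` A \<inter> space M | r A. r \<in> T \<and> A \<in> sets borel}"

lemma increments_algebra_sigma_algebra: "sigma_algebra (space M) (increments_algebra M B a T)"
  unfolding increments_algebra_def by (rule sigma_algebra_sigma_sets) auto

lemma increments_algebra_mono: "S \<subseteq> T \<Longrightarrow> increments_algebra M B a S \<subseteq> increments_algebra M B a T"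
  unfolding increments_algebra_def by (rule sigma_sets_mono') blast

lemma increments_algebra_vimage:
  "r \<in> T \<Longrightarrow> A \<in> sets borel \<Longrightarrow> (\<lambda>\<omega>. B r \<omega> - B a \<omega>) -` A \<inter> space M \<in> increments_algebra M B a T"
  unfolding increments_algebra_def by (rule sigma_sets.Basic) blast

text \<open>The base point cancels when two generators are subtracted.\<close>

lemma increments_algebra_increment:
  assumes "r \<in> T" "s \<in> T" "A \<in> sets borel"
  shows "(\<lambda>\<omega>. B r \<omega> - B s \<omega>) -` A \<inter> space M \<in> increments_algebra M B a T"
proof -
  define N where "N = sigma (space M) (increments_algebra M B a T)"
  interpret sigma_algebra "space M" "increments_algebra M B a T"
    by (rule increments_algebra_sigma_algebra)
  have N: "sets N = increments_algebra M B a T" "space N = space M"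
    using space_closed by (simp_all add: N_def sigma_sets_eq)
  have m: "(\<lambda>\<omega>. B q \<omega> - B a \<omega>) \<in> borel_measurable N" if "q \<in> T" for q
    using that by (auto simp: measurable_def N increments_algebra_vimage)
  have "(\<lambda>\<omega>. (B r \<omega> - B a \<omega>) - (B s \<omega> - B a \<omega>)) \<in> borel_measurable N"
    using assms by (intro borel_measurable_diff m)
  from measurable_sets[OF this assms(3)] show ?thesis by (simp add: N)
qed

lemma increments_algebra_rebase:
  assumes "u \<in> T" "S \<subseteq> T"
  shows "increments_algebra M B u S \<subseteq> increments_algebra M B a T"
proof -
  interpret sigma_algebra "space M" "increments_algebra M B a T"
    by (rule increments_algebra_sigma_algebra)
  show ?thesis
    unfolding increments_algebra_def[of M B u S]
    by (rule sigma_sets_subset) (use assms in \<open>auto intro!: increments_algebra_increment\<close>)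
qed

text \<open>Each generator involves one time only. Independence can therefore be checked on finitely
  many times.\<close>

lemma increments_algebra_finite_subsets:
  "increments_algebra M B a T = sigma_sets (space M) (\<Union>S\<in>{S. finite S \<and> S \<subseteq> T}. increments_algebra M B a S)"
  (is "_ = sigma_sets _ ?U")
proof (rule antisym)
  interpret sigma_algebra "space M" "increments_algebra M B a T"
    by (rule increments_algebra_sigma_algebra)
  show "sigma_sets (space M) ?U \<subseteq> increments_algebra M B a T"
    by (rule sigma_sets_subset, rule UN_least, rule increments_algebra_mono) simp
  show "increments_algebra M B a T \<subseteq> sigma_sets (space M) ?U"
    unfolding increments_algebra_def[of M B a T]
  proof (rule sigma_sets_mono', safe)
    fix r A assume "r \<in> T" "A \<in> sets (borel :: real measure)"
    then show "(\<lambda>\<omega>. B r \<omega> - B a \<omega>) -` A \<inter> space M \<in> ?U"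
      using increments_algebra_vimage[of r "{r}"] by blast
  qed
qed

text \<open>Finite sets of times are directed under union, so two events share a common
  \<sigma>-algebra.\<close>

lemma Int_stable_increments_algebra_finite:
  "Int_stable (\<Union>S\<in>{S. finite S \<and> S \<subseteq> T}. increments_algebra M B a S)"
  (is "Int_stable ?U")
proof (rule Int_stableI)
  fix x y assume "x \<in> ?U" "y \<in> ?U"
  then obtain S S' where *: "x \<in> increments_algebra M B a S" "finite S" "S \<subseteq> T"
    "y \<in> increments_algebra M B a S'" "finite S'" "S' \<subseteq> T" by (elim UN_E CollectE conjE) (rule that)
  interpret sigma_algebra "space M" "increments_algebra M B a (S \<union> S')"
    by (rule increments_algebra_sigma_algebra)
  have "x \<inter> y \<in> increments_algebra M B a (S \<union> S')"
    using subsetD[OF increments_algebra_mono[OF Un_upper1] *(1)]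
      subsetD[OF increments_algebra_mono[OF Un_upper2] *(4)] by (intro Int) auto
  then show "x \<inter> y \<in> ?U"
    by (rule UN_I[rotated]) (use * in simp)
qed

section \<open>Independence of Brownian increments before and after a fixed time\<close>

locale complete_brownian_motion = prob_space M + complete_measure M for M :: "'a measure" +
  fixes B :: "real \<Rightarrow> 'a \<Rightarrow> real"
  assumes brownian: "standard_brownian_motion M B"
begin

lemma measurable_B[measurable]: "t \<ge> 0 \<Longrightarrow> B t \<in> borel_measurable M"
  and B_0: "AE \<omega> in M. B 0 \<omega> = 0"
  and continuous_B: "AE \<omega> in M. continuous_on {0..} (\<lambda>t. B t \<omega>)"
  and distributed_increment: "0 \<le> s \<Longrightarrow> s < t \<Longrightarrow>
        distributed M lborel (\<lambda>\<omega>. B t \<omega> - B s \<omega>) (normal_density 0 (sqrt (t - s)))"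
  and indep_increments: "0 \<le> p 0 \<Longrightarrow> (\<And>i. i < n \<Longrightarrow> p i < p (Suc i)) \<Longrightarrow>
        indep_vars (\<lambda>_. borel) (\<lambda>i \<omega>. B (p (Suc i)) \<omega> - B (p i) \<omega>) {..<n}"
  using brownian unfolding standard_brownian_motion_def by auto

text \<open>All times are merged into one increasing grid. Consecutive grid increments are
  independent, and those before and after \<open>u\<close> form two disjoint blocks.\<close>

lemma indep_finite_increments:
  assumes S: "finite S" "S \<subseteq> {0..u}" and R: "finite R" "R \<subseteq> {u..}" and u: "0 \<le> u"
  shows "indep_set (increments_algebra M B 0 S) (increments_algebra M B u R)"
proof -
  \<comment> \<open>Inserting 0 and \<open>u\<close> makes both base points grid points. The grid is
    \<open>p 0\<close>, ..., \<open>p n\<close>, with \<open>n\<close> increments, hence the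
    subtraction of 1 from the length.\<close>
  define xs where "xs = sorted_list_of_set (insert 0 (insert u (S \<union> R)))"
  define n where "n = length xs - 1"
  define p where "p i = xs ! i" for i
  define D where "D i \<omega> = B (p (Suc i)) \<omega> - B (p i) \<omega>" for i \<omega>
  have set_xs: "set xs = insert 0 (insert u (S \<union> R))"
    unfolding xs_def by (rule set_sorted_list_of_set) (use S R in simp)
  have sorted: "sorted_wrt (<) xs" by (simp add: xs_def)
  have less: "p i < p j" if "i < j" "j \<le> n" for i j
    using sorted_wrt_nth_less[OF sorted that(1)] that set_xs by (cases xs) (auto simp: p_def n_def)
  have idx: "\<exists>i\<le>n. q = p i" if q: "q \<in> set xs" for q
  proof -
    obtain i where "i < length xs" "q = xs ! i" using q unfolding in_set_conv_nth by blast
    then show ?thesis by (intro exI[of _ i]) (auto simp: p_def n_def)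
  qed
  obtain k where k: "k \<le> n" "u = p k" using idx[of u] set_xs by auto
  have nonneg: "0 \<le> q" if "q \<in> set xs" for q
    using that set_xs S R u by auto
  have "length xs > 0" using set_xs by (cases xs) auto
  then have p_in: "p i \<in> set xs" if "i \<le> n" for i
    using that unfolding p_def n_def by (intro nth_mem) linarith
  have p0: "p 0 = 0"
  proof -
    obtain i where i: "i \<le> n" "0 = p i" using idx[of 0] set_xs by auto
    then have "i = 0" using less[of 0 i] nonneg[OF p_in, of 0] by (cases "i = 0") auto
    with i show ?thesis by simp
  qed
  have ind: "indep_vars (\<lambda>_. borel) D {..<n}"
    unfolding D_def by (rule indep_increments) (use p0 less in auto)
  have tele: "B (p j) \<omega> - B (p i) \<omega> = (\<Sum>l\<in>{i..<j}. D l \<omega>)" if "i \<le> j" for i j \<omega>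
    unfolding D_def by (rule sum_Suc_diff'[OF that, symmetric])
  define V where "V K \<omega> = restrict (\<lambda>i. D i \<omega>) K" for K \<omega>
  \<comment> \<open>As \<open>u\<close> is \<open>p k\<close>, the increments with index below
    \<open>k\<close> end by time \<open>u\<close> and the others start at \<open>u\<close> or
    later.\<close>
  have "indep_var (PiM {..<k} (\<lambda>_. borel)) (V {..<k}) (PiM {k..<n} (\<lambda>_. borel)) (V {k..<n})"
    unfolding V_def by (rule indep_var_restrict[OF ind]) (use k in auto)
  then have indV: "indep_set
      (sigma_sets (space M) {V {..<k} -` A \<inter> space M | A. A \<in> sets (PiM {..<k} (\<lambda>_. borel))})
      (sigma_sets (space M) {V {k..<n} -` A \<inter> space M | A. A \<in> sets (PiM {k..<n} (\<lambda>_. borel))})"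
    by (simp add: indep_var_eq)
  \<comment> \<open>By telescoping, an increment from \<open>p i\<close> is a measurable function of
    any block \<open>V K\<close> that contains all grid increments in between.\<close>
  have sub: "increments_algebra M B (p i) T \<subseteq>
      sigma_sets (space M) {V K -` A \<inter> space M | A. A \<in> sets (PiM K (\<lambda>_. borel))}"
    if T: "\<And>q. q \<in> T \<Longrightarrow> \<exists>j. i \<le> j \<and> q = p j \<and> {i..<j} \<subseteq> K" for i T K
    unfolding increments_algebra_def
  proof (rule sigma_sets_mono', safe)
    fix q A assume "q \<in> T" and A: "A \<in> sets (borel :: real measure)"
    from T[OF \<open>q \<in> T\<close>] obtain j where j: "i \<le> j" "q = p j" "{i..<j} \<subseteq> K" by blast
    define g where "g x = (\<Sum>l\<in>{i..<j}. x l)" for x :: "nat \<Rightarrow> real"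
    have g: "g \<in> borel_measurable (PiM K (\<lambda>_. borel))"
      unfolding g_def using j(3) by (intro borel_measurable_sum measurable_component_singleton) auto
    have eq: "B q \<omega> - B (p i) \<omega> = g (V K \<omega>)" for \<omega>
      unfolding j(2) tele[OF j(1)] g_def V_def using j(3) by (intro sum.cong) auto
    have "(\<lambda>\<omega>. B q \<omega> - B (p i) \<omega>) -` A \<inter> space M = V K -` (g -` A \<inter> space (PiM K (\<lambda>_. borel))) \<inter> space M"
      by (auto simp: eq space_PiM V_def)
    moreover have "g -` A \<inter> space (PiM K (\<lambda>_. borel)) \<in> sets (PiM K (\<lambda>_. borel))"
      using g A by (rule measurable_sets)
    ultimately show "\<exists>A'. (\<lambda>\<omega>. B q \<omega> - B (p i) \<omega>) -` A \<inter> space M = V K -` A' \<inter> space M \<and>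
        A' \<in> sets (PiM K (\<lambda>_. borel))" by blast
  qed
  have le: "i \<le> j" if "p i \<le> p j" "i \<le> n" for i j
    using less[of j i] that by (cases "i \<le> j") auto
  have 1: "increments_algebra M B 0 S \<subseteq>
      sigma_sets (space M) {V {..<k} -` A \<inter> space M | A. A \<in> sets (PiM {..<k} (\<lambda>_. borel))}"
  proof (subst p0[symmetric], rule sub)
    fix q assume "q \<in> S"
    then obtain j where j: "j \<le> n" "q = p j" using idx[of q] set_xs by auto
    moreover have "j \<le> k" by (rule le) (use \<open>q \<in> S\<close> S(2) j k in auto)
    ultimately show "\<exists>j\<ge>0. q = p j \<and> {0..<j} \<subseteq> {..<k}" by (intro exI[of _ j]) auto
  qed
  have 2: "increments_algebra M B u R \<subseteq>
      sigma_sets (space M) {V {k..<n} -` A \<inter> space M | A. A \<in> sets (PiM {k..<n} (\<lambda>_. borel))}"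
  proof (subst k(2), rule sub)
    fix q assume "q \<in> R"
    then obtain j where j: "j \<le> n" "q = p j" using idx[of q] set_xs by auto
    moreover have "k \<le> j" by (rule le) (use \<open>q \<in> R\<close> R(2) j k in auto)
    ultimately show "\<exists>j\<ge>k. q = p j \<and> {k..<j} \<subseteq> {k..<n}" by (intro exI[of _ j]) auto
  qed
  show ?thesis
    using indV 1 2 unfolding indep_sets2_eq by blast
qed

text \<open>The unions over finite sets of times are \<pi>-systems generating the two sides, so
  independence extends from them.\<close>

lemma indep_past_future_increments:
  assumes u: "0 \<le> u"
  shows "indep_set (increments_algebra M B 0 {0..u}) (increments_algebra M B u {u..})"
  unfolding increments_algebra_finite_subsets[of M B 0 "{0..u}"]
    increments_algebra_finite_subsets[of M B u "{u..}"]
proof (rule indep_set_sigma_sets)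
  show "indep_set (\<Union>S\<in>{S. finite S \<and> S \<subseteq> {0..u}}. increments_algebra M B 0 S)
     (\<Union>S\<in>{S. finite S \<and> S \<subseteq> {u..}}. increments_algebra M B u S)"
  proof (rule indep_setI)
    fix a b
    assume "a \<in> (\<Union>S\<in>{S. finite S \<and> S \<subseteq> {0..u}}. increments_algebra M B 0 S)"
      and "b \<in> (\<Union>S\<in>{S. finite S \<and> S \<subseteq> {u..}}. increments_algebra M B u S)"
    then show "prob (a \<inter> b) = prob a * prob b"
      by (elim UN_E CollectE conjE)
        (rule indep_setD[OF indep_finite_increments[OF _ _ _ _ u]])
  next
    \<comment> \<open>Taking no times on the opposite side extracts mere measurability from the
      finite independence statement.\<close>
    show "(\<Union>S\<in>{S. finite S \<and> S \<subseteq> {0..u}}. increments_algebra M B 0 S) \<subseteq> events"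
      using indep_setD_ev1[OF indep_finite_increments[of _ u "{}"]] u by (intro UN_least) simp
    show "(\<Union>S\<in>{S. finite S \<and> S \<subseteq> {u..}}. increments_algebra M B u S) \<subseteq> events"
      using indep_setD_ev2[OF indep_finite_increments[of "{}" u]] u by (intro UN_least) simp
  qed
qed (rule Int_stable_increments_algebra_finite)+

end

subsection \<open>Right-continuity of the completed Brownian filtration\<close>

lemma space_completed_natural_filtration[simp]: "space (completed_natural_filtration M X t) = space M"
  by (simp add: completed_natural_filtration_def space_measure_of_conv)

lemma sets_completed_natural_filtration:
  "sets (completed_natural_filtration M X t) = sigma_sets (space M)
     ({X s -` A \<inter> space M | s A. 0 \<le> s \<and> s \<le> t \<and> A \<in> sets borel} \<union> null_sets M)"
  unfolding completed_natural_filtration_def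
  by (rule sets_measure_of) (auto dest: sets.sets_into_space)

lemma null_sets_completed_natural_filtration: "null_sets M \<subseteq> sets (completed_natural_filtration M X t)"
  unfolding sets_completed_natural_filtration by (auto intro: sigma_sets.Basic)

lemma measurable_completed_natural_filtration:
  assumes "0 \<le> s" "s \<le> t"
  shows "X s \<in> borel_measurable (completed_natural_filtration M X t)"
proof (rule measurableI)
  fix A assume "A \<in> sets (borel :: real measure)"
  with assms show "X s -` A \<inter> space (completed_natural_filtration M X t)
      \<in> sets (completed_natural_filtration M X t)"
    unfolding sets_completed_natural_filtration by (auto intro!: sigma_sets.Basic)
qed simp

lemma completed_natural_filtration_mono:
  assumes "s \<le> t"
  shows "sets (completed_natural_filtration M X s) \<subseteq> sets (completed_natural_filtration M X t)"
  unfolding sets_completed_natural_filtration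
proof (rule sigma_sets_mono', rule Un_mono[OF _ order_refl], safe)
  fix r A assume "0 \<le> r" "r \<le> s" "A \<in> sets (borel :: real measure)"
  with assms show "\<exists>q E. X r -` A \<inter> space M = X q -` E \<inter> space M \<and> 0 \<le> q \<and> q \<le> t \<and> E \<in> sets borel"
    by (intro exI[of _ r] exI[of _ A]) auto
qed

lemma subalgebra_completed_natural_filtration:
  assumes "\<And>s. 0 \<le> s \<Longrightarrow> X s \<in> borel_measurable M"
  shows "subalgebra M (completed_natural_filtration M X t)"
proof -
  have "X s -` A \<inter> space M \<in> sets M" if "0 \<le> s" "A \<in> sets borel" for s A
    using assms[OF that(1)] that(2) by (rule measurable_sets)
  then show ?thesis
    unfolding subalgebra_def sets_completed_natural_filtration
    by (intro conjI sets.sigma_sets_subset Un_least) (auto simp: space_measure_of_conv)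
qed

text \<open>The tool for comparing filtrations on an event: it suffices to replace each
  \<open>X s\<close> there by an \<open>N\<close>-measurable variable, since null sets agree with
  the empty set almost surely. With \<open>P\<close> constantly true it compares whole
  \<sigma>-algebras.\<close>

lemma completed_natural_filtration_AE_trace:
  assumes A: "A \<in> sets (completed_natural_filtration M X u)" and N: "space N = space M"
    and X: "\<And>s. 0 \<le> s \<Longrightarrow> s \<le> u \<Longrightarrow> \<exists>Y\<in>borel_measurable N. AE \<omega> in M. P \<omega> \<longrightarrow> X s \<omega> = Y \<omega>"
  shows "\<exists>h\<in>sets N. AE \<omega> in M. P \<omega> \<longrightarrow> (\<omega> \<in> A \<longleftrightarrow> \<omega> \<in> h)"
  using A unfolding sets_completed_natural_filtration
proof (rule sigma_sets_AE_trace)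
  show "sigma_algebra (space M) (sets N)"
    using sets.sigma_algebra_axioms[of N] by (simp add: N)
  fix g assume "g \<in> {X s -` E \<inter> space M | s E. 0 \<le> s \<and> s \<le> u \<and> E \<in> sets borel} \<union> null_sets M"
  then show "\<exists>h\<in>sets N. AE \<omega> in M. P \<omega> \<longrightarrow> (\<omega> \<in> g \<longleftrightarrow> \<omega> \<in> h)"
  proof
    assume "g \<in> {X s -` E \<inter> space M | s E. 0 \<le> s \<and> s \<le> u \<and> E \<in> sets borel}"
    then obtain s E where g: "g = X s -` E \<inter> space M" "0 \<le> s" "s \<le> u" and E: "E \<in> sets borel" by blast
    from X[OF g(2,3)] obtain Y where Y: "Y \<in> borel_measurable N" and ae: "AE \<omega> in M. P \<omega> \<longrightarrow> X s \<omega> = Y \<omega>"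
      by blast
    have "AE \<omega> in M. P \<omega> \<longrightarrow> (\<omega> \<in> g \<longleftrightarrow> \<omega> \<in> Y -` E \<inter> space N)"
      using ae AE_space by eventually_elim (auto simp: g N)
    with measurable_sets[OF Y E] show ?thesis by blast
  next
    assume "g \<in> null_sets M"
    then have "AE \<omega> in M. P \<omega> \<longrightarrow> (\<omega> \<in> g \<longleftrightarrow> \<omega> \<in> {})"
      using AE_not_in[of g M] by auto
    then show ?thesis by blast
  qed
qed

section \<open>Passing from the right limit of the Brownian filtration to the present\<close>

context complete_brownian_motion
begin

abbreviation "\<F> \<equiv> completed_natural_filtration M B"

lemma subalgebra_brownian_filtration: "subalgebra M (\<F> t)"
  by (rule subalgebra_completed_natural_filtration) (rule measurable_B)

text \<open>Almost surely \<open>B s\<close> equals \<open>B s - B 0\<close>, so every event of the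
  completed past differs by a null set from one generated by increments.\<close>

lemma indep_filtration_future_increments:
  assumes u: "0 \<le> u"
  shows "indep_set (sets (\<F> u)) (increments_algebra M B u {u..})"
proof (rule indep_set_AE_cong[OF indep_past_future_increments[OF u]])
  show "sets (\<F> u) \<subseteq> events"
    using subalgebra_brownian_filtration by (simp add: subalgebra_def)
  define N where "N = sigma (space M) (increments_algebra M B 0 {0..u})"
  interpret I: sigma_algebra "space M" "increments_algebra M B 0 {0..u}"
    by (rule increments_algebra_sigma_algebra)
  have N: "sets N = increments_algebra M B 0 {0..u}" "space N = space M"
    using I.space_closed by (simp_all add: N_def I.sigma_sets_eq)
  fix a assume "a \<in> sets (\<F> u)"
  then have "\<exists>h\<in>sets N. AE \<omega> in M. True \<longrightarrow> (\<omega> \<in> a \<longleftrightarrow> \<omega> \<in> h)"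
  proof (rule completed_natural_filtration_AE_trace)
    fix s assume s: "0 \<le> s" "s \<le> u"
    have "(\<lambda>\<omega>. B s \<omega> - B 0 \<omega>) \<in> borel_measurable N"
      by (rule measurableI) (use s in \<open>auto simp: N intro: increments_algebra_vimage\<close>)
    moreover have "AE \<omega> in M. True \<longrightarrow> B s \<omega> = B s \<omega> - B 0 \<omega>" using B_0 by eventually_elim simp
    ultimately show "\<exists>Y\<in>borel_measurable N. AE \<omega> in M. True \<longrightarrow> B s \<omega> = Y \<omega>"
      by (intro bexI[of _ "\<lambda>\<omega>. B s \<omega> - B 0 \<omega>"])
  qed (rule N(2))
  then show "\<exists>h\<in>increments_algebra M B 0 {0..u}. AE \<omega> in M. \<omega> \<in> a \<longleftrightarrow> \<omega> \<in> h"
    by (simp add: N)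
qed

text \<open>\<open>indep_enlargement_trivial\<close> is applied to \<open>\<F> t\<close>, the germ
  \<sigma>-algebra \<open>\<H>\<close> and the increments \<open>\<G>\<close> after
  \<open>t\<close>: \<open>H\<close> lies in \<open>\<H>\<close> and in the \<sigma>-algebra
  generated by \<open>\<F> t\<close> and \<open>\<G>\<close>.\<close>

lemma brownian_filtration_right_continuous:
  assumes t: "0 \<le> t" and H: "\<And>u. t < u \<Longrightarrow> H \<in> sets (\<F> u)"
  shows "H \<in> sets (\<F> t)"
proof -
  define r where "r n = t + 1 / real (Suc n)" for n
  define \<H> where "\<H> = (\<Inter>u\<in>{t<..}. sets (\<F> u))"
  \<comment> \<open>Starting at \<open>r n\<close> rather than \<open>t\<close> leaves room for the
    germ: \<open>\<H>\<close> is contained in \<open>\<F> (r n)\<close>, which is independent of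
    \<open>I n\<close>.\<close>
  define I where "I n = increments_algebra M B (r n) {r n..}" for n
  define \<G> where "\<G> = sigma_sets (space M) (\<Union>n. I n)"
  define N where "N = sigma (space M) (sets (\<F> t) \<union> \<G>)"
  have r: "t < r n" "0 \<le> r n" for n using t by (simp_all add: r_def add_nonneg_nonneg)
  have FM: "sets (\<F> u) \<subseteq> events" for u
    using subalgebra_brownian_filtration by (simp add: subalgebra_def)
  have indI: "indep_set (sets (\<F> (r n))) (I n)" for n
    unfolding I_def by (rule indep_filtration_future_increments[OF r(2)])
  have IM: "I n \<subseteq> events" for n by (rule indep_setD_ev2[OF indI])
  \<comment> \<open>As \<open>r\<close> decreases, the later families see more of the future, so
    their union is a \<pi>-system.\<close>
  have I_mono: "I m \<subseteq> I n" if "m \<le> n" for m n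
  proof -
    have "r n \<le> r m" using that by (simp add: r_def frac_le)
    then show ?thesis unfolding I_def by (intro increments_algebra_rebase) auto
  qed
  have stabI: "Int_stable (\<Union>n. I n)"
  proof (rule Int_stableI)
    fix a b assume "a \<in> (\<Union>n. I n)" "b \<in> (\<Union>n. I n)"
    then obtain m n where mn: "a \<in> I m" "b \<in> I n" by auto
    interpret I: sigma_algebra "space M" "I (max m n)"
      unfolding I_def by (rule increments_algebra_sigma_algebra)
    have "a \<in> I (max m n)" "b \<in> I (max m n)"
      using I_mono[of m "max m n"] I_mono[of n "max m n"] mn by auto
    then show "a \<inter> b \<in> (\<Union>n. I n)" by (intro UN_I[of "max m n"] I.Int) auto
  qed
  have stabH: "Int_stable \<H>"
    by (rule Int_stableI) (auto simp: \<H>_def)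
  have "indep_set \<H> (\<Union>n. I n)"
  proof (rule indep_setI)
    show "\<H> \<subseteq> events" using FM[of "t + 1"] by (auto simp: \<H>_def)
    show "(\<Union>n. I n) \<subseteq> events" using IM by blast
    fix a b assume "a \<in> \<H>" "b \<in> (\<Union>n. I n)"
    then obtain n where "b \<in> I n" "a \<in> sets (\<F> (r n))" using r by (auto simp: \<H>_def)
    then show "prob (a \<inter> b) = prob a * prob b" by (intro indep_setD[OF indI])
  qed
  from indep_set_sigma_sets[OF this stabH stabI]
  have indHG: "indep_set \<H> \<G>"
    unfolding \<G>_def indep_sets2_eq by (auto intro: sigma_sets.Basic)
  interpret G: sigma_algebra "space M" \<G>
    unfolding \<G>_def by (rule sigma_algebra_sigma_sets) (intro UN_least subset_trans[OF IM sets.space_closed])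
  have GM: "\<G> \<subseteq> events" by (rule indep_setD_ev2[OF indHG])
  have N: "sets N = sigma_sets (space M) (sets (\<F> t) \<union> \<G>)" "space N = space M"
    unfolding N_def using subset_trans[OF FM sets.space_closed] subset_trans[OF GM sets.space_closed]
    by (simp_all add: space_measure_of_conv)
  have FN: "sets (\<F> t) \<subseteq> sets N" and GN: "\<G> \<subseteq> sets N"
    unfolding N by (auto intro: sigma_sets.Basic)
  have subN: "subalgebra M N"
    unfolding subalgebra_def N using FM[of t] GM by (auto intro!: sets.sigma_sets_subset)
  have nullN: "null_sets M \<subseteq> sets N"
    using null_sets_completed_natural_filtration FN by (rule subset_trans)
  have BN: "B s \<in> borel_measurable N" if s: "0 \<le> s" for s
  proof (cases "s \<le> t")
    case True
    then have "B s \<in> borel_measurable (\<F> t)"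
      using s by (intro measurable_completed_natural_filtration)
    then show ?thesis using FN by (auto simp: measurable_def N)
  next
    case False
    have r_lim: "r \<longlonglongrightarrow> t"
      unfolding r_def using tendsto_add[OF tendsto_const LIMSEQ_inverse_real_of_nat, of t]
      by (simp add: inverse_eq_divide)
    \<comment> \<open>The shift by \<open>n0\<close> ensures that \<open>s\<close> is an admissible
      time for the increments from \<open>r (n + n0)\<close>.\<close>
    then obtain n0 where n0: "\<And>n. n \<ge> n0 \<Longrightarrow> r n < s"
      using order_tendstoD(2)[of r t sequentially s] False by (auto simp: eventually_sequentially)
    have Bt: "B t \<in> borel_measurable N"
      using measurable_completed_natural_filtration[OF t order_refl, where X = B and M = M] FN
      by (auto simp: measurable_def N)
    have inc: "(\<lambda>\<omega>. B s \<omega> - B (r (n + n0)) \<omega>) \<in> borel_measurable N" for n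
    proof (rule measurableI)
      fix A assume A: "A \<in> sets (borel :: real measure)"
      have "(\<lambda>\<omega>. B s \<omega> - B (r (n + n0)) \<omega>) -` A \<inter> space M \<in> I (n + n0)"
        unfolding I_def by (rule increments_algebra_vimage) (use n0[of "n + n0"] A in auto)
      then show "(\<lambda>\<omega>. B s \<omega> - B (r (n + n0)) \<omega>) -` A \<inter> space N \<in> sets N"
        using GN by (auto simp: N(2) \<G>_def intro: sigma_sets.Basic)
    qed simp
    \<comment> \<open>Continuity at \<open>t\<close> recovers \<open>B s - B t\<close> from
      increments strictly after \<open>t\<close>; paths without continuity are absorbed by the null
      sets in \<open>N\<close>.\<close>
    have "(\<lambda>\<omega>. lim (\<lambda>n. B s \<omega> - B (r (n + n0)) \<omega>) + B t \<omega>) \<in> borel_measurable N"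
      by (intro borel_measurable_add borel_measurable_lim_metric inc Bt)
    moreover have "AE \<omega> in M. lim (\<lambda>n. B s \<omega> - B (r (n + n0)) \<omega>) + B t \<omega> = B s \<omega>"
      using continuous_B
    proof eventually_elim
      case (elim \<omega>)
      have "(\<lambda>n. B (r (n + n0)) \<omega>) \<longlonglongrightarrow> B t \<omega>"
        by (rule continuous_on_tendsto_compose[OF elim LIMSEQ_ignore_initial_segment[OF r_lim]])
          (use t r in auto)
      then have "(\<lambda>n. B s \<omega> - B (r (n + n0)) \<omega>) \<longlonglongrightarrow> B s \<omega> - B t \<omega>"
        by (intro tendsto_diff tendsto_const)
      then show ?case by (simp add: limI)
    qed
    ultimately show ?thesis by (rule measurable_subalgebra_AE[OF subN nullN]) simp
  qed
  have FH: "sets (\<F> t) \<subseteq> \<H>"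
    unfolding \<H>_def by (intro INT_greatest completed_natural_filtration_mono) simp
  have HH: "H \<in> \<H>" using H by (simp add: \<H>_def)
  have HM: "H \<subseteq> space M" using H[of "t + 1"] FM sets.sets_into_space by fastforce
  \<comment> \<open>All \<open>B s\<close> are \<open>N\<close>-measurable, so \<open>N\<close>
    contains \<open>\<F> (t + 1)\<close> up to null sets, and \<open>H\<close> belongs to the
    latter.\<close>
  have "\<exists>h\<in>sets N. AE \<omega> in M. True \<longrightarrow> (\<omega> \<in> H \<longleftrightarrow> \<omega> \<in> h)"
    by (rule completed_natural_filtration_AE_trace[OF H[of "t + 1"]]) (use BN N in auto)
  then have HN: "H \<in> sets N"
    using in_subalgebra_AE[OF subN nullN _ _ HM] by auto
  have "\<exists>a\<in>sets (\<F> t). AE \<omega> in M. \<omega> \<in> H \<longleftrightarrow> \<omega> \<in> a"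
    by (rule indep_enlargement_trivial[OF subalgebra_brownian_filtration FH indHG stabH G.Int_stable G.top HH])
      (use HN in \<open>simp add: N\<close>)
  then show ?thesis
    using in_subalgebra_AE[OF subalgebra_brownian_filtration null_sets_completed_natural_filtration _ _ HM]
    by blast
qed

end

subsection \<open>The process stopped at the last passage time\<close>

text \<open>A value strictly below a supremum, finite or not, is exceeded by a member. For
  \<open>0 \<le> t\<close> the embedding \<open>ennreal\<close> loses no strict inequality, and
  times after \<open>t\<close> are positive.\<close>

lemma last_passage_time_gt_iff:
  assumes "0 \<le> t"
  shows "ennreal t < last_passage_time X z \<omega> \<longleftrightarrow> (\<exists>s>t. X s \<omega> = z)"
proof
  assume "ennreal t < last_passage_time X z \<omega>"
  then obtain s where "0 < s" "X s \<omega> = z" "ennreal t < ennreal s"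
    unfolding last_passage_time_def less_Sup_iff by blast
  then show "\<exists>s>t. X s \<omega> = z" using assms by (intro exI[of _ s]) (simp add: ennreal_less_iff)
next
  assume "\<exists>s>t. X s \<omega> = z"
  then obtain s where s: "t < s" "X s \<omega> = z" by blast
  then have "ennreal s \<in> {ennreal t | t. t > 0 \<and> X t \<omega> = z}" using assms by (intro CollectI exI[of _ s]) auto
  moreover have "ennreal t < ennreal s" using s assms by (simp add: ennreal_less_iff)
  ultimately show "ennreal t < last_passage_time X z \<omega>"
    unfolding last_passage_time_def less_Sup_iff by (intro bexI[of _ "ennreal s"])
qed

text \<open>A description by countably many rational times, for measurability. The compact windows
  stay away from \<open>t\<close>, so a limit of approximate hits is still strictly later than
  \<open>t\<close>.\<close>

lemma hit_iff_rational_approximation: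
  fixes f :: "real \<Rightarrow> real" and t z :: real
  assumes f: "continuous_on {0..} f" and t: "0 \<le> t"
  shows "(\<exists>s>t. f s = z) \<longleftrightarrow>
    (\<exists>N::nat. \<forall>k::nat. \<exists>q\<in>\<rat> \<inter> {t + 1 / Suc N..t + Suc N}. \<bar>f q - z\<bar> < 1 / Suc k)"
proof
  assume "\<exists>s>t. f s = z"
  then obtain s where s: "t < s" "f s = z" by blast
  obtain n1 where n1: "1 / real (Suc n1) < s - t"
    using reals_Archimedean[of "s - t"] s by (auto simp: inverse_eq_divide)
  obtain n2 :: nat where n2: "s - t < n2" using reals_Archimedean2 by blast
  define N where "N = max n1 n2"
  have "1 / real (Suc N) \<le> 1 / real (Suc n1)" by (simp add: N_def frac_le)
  then have N1: "t + 1 / real (Suc N) < s" using n1 by simp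
  have "real n2 \<le> real (Suc N)" by (simp add: N_def)
  then have N2: "s < t + real (Suc N)" using n2 by linarith
  have "\<exists>q\<in>\<rat> \<inter> {t + 1 / real (Suc N)..t + real (Suc N)}. \<bar>f q - z\<bar> < 1 / real (Suc k)" for k
  proof -
    obtain d where d: "0 < d" "\<And>x. x \<in> {0..} \<Longrightarrow> dist x s < d \<Longrightarrow> dist (f x) (f s) < 1 / real (Suc k)"
      using f[unfolded continuous_on_iff, rule_format, of s "1 / real (Suc k)"] s t by auto
    \<comment> \<open>The maximum keeps \<open>q\<close> both inside the window and within
      \<open>d\<close> of \<open>s\<close>.\<close>
    obtain q where q: "q \<in> \<rat>" "max (t + 1 / real (Suc N)) (s - d) < q" "q < s"
      using Rats_dense_in_real[of "max (t + 1 / real (Suc N)) (s - d)" s] N1 d(1) by auto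
    have "0 \<le> 1 / real (Suc N)" by simp
    then have "0 \<le> q" using q t by linarith
    with d(2)[of q] q s have "\<bar>f q - z\<bar> < 1 / real (Suc k)" by (simp add: dist_real_def)
    with q N2 show ?thesis by (intro bexI[of _ q]) auto
  qed
  then show "\<exists>N::nat. \<forall>k::nat. \<exists>q\<in>\<rat> \<inter> {t + 1 / Suc N..t + Suc N}. \<bar>f q - z\<bar> < 1 / Suc k" by blast
next
  assume "\<exists>N::nat. \<forall>k::nat. \<exists>q\<in>\<rat> \<inter> {t + 1 / Suc N..t + Suc N}. \<bar>f q - z\<bar> < 1 / Suc k"
  then obtain N where N: "\<And>k. \<exists>q\<in>\<rat> \<inter> {t + 1 / real (Suc N)..t + real (Suc N)}. \<bar>f q - z\<bar> < 1 / real (Suc k)"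
    by blast
  define K where "K = {t + 1 / real (Suc N)..t + real (Suc N)}"
  have pos: "0 < 1 / real (Suc N)" by simp
  have "continuous_on K f"
    using f by (rule continuous_on_subset) (use pos t in \<open>auto simp: K_def simp del: of_nat_Suc\<close>)
  then have cont: "continuous_on K (\<lambda>x. \<bar>f x - z\<bar>)" by (intro continuous_intros)
  have "compact K" "K \<noteq> {}" using N[of 0] by (auto simp: K_def)
  \<comment> \<open>The attained minimum of the distance to \<open>z\<close> lies below every
    \<open>1 / real (Suc k)\<close>, hence is zero.\<close>
  from continuous_attains_inf[OF this cont]
  obtain x where x: "x \<in> K" "\<And>y. y \<in> K \<Longrightarrow> \<bar>f x - z\<bar> \<le> \<bar>f y - z\<bar>" by auto
  have "\<bar>f x - z\<bar> < 1 / real (Suc k)" for k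
  proof -
    from N[of k] obtain q where "q \<in> \<rat> \<inter> {t + 1 / real (Suc N)..t + real (Suc N)}"
      and q: "\<bar>f q - z\<bar> < 1 / real (Suc k)" by (rule bexE)
    then have "q \<in> K" unfolding K_def by simp
    then show ?thesis using q by (rule order.strict_trans1[OF x(2)])
  qed
  then have "\<not> 0 < \<bar>f x - z\<bar>"
    using reals_Archimedean[of "\<bar>f x - z\<bar>"] unfolding inverse_eq_divide by (meson less_asym)
  moreover have "t + 1 / real (Suc N) \<le> x" using x(1) unfolding K_def by simp
  then have "t < x" using pos by linarith
  ultimately show "\<exists>s>t. f s = z" by (intro exI[of _ x]) auto
qed

text \<open>Otherwise continuity excludes hits near \<tau>, while the supremum forces hits just
  before or at \<tau> and forbids later ones.\<close>

lemma at_last_passage_time: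
  assumes cont: "continuous_on {0..} (\<lambda>t. X t \<omega>)"
    and T: "last_passage_time X z \<omega> = ennreal \<tau>" "0 < \<tau>"
  shows "X \<tau> \<omega> = z"
proof (rule ccontr)
  assume "X \<tau> \<omega> \<noteq> z"
  then obtain d where d: "0 < d" "\<And>x. x \<in> {0..} \<Longrightarrow> dist x \<tau> < d \<Longrightarrow> dist (X x \<omega>) (X \<tau> \<omega>) < \<bar>X \<tau> \<omega> - z\<bar>"
    using cont[unfolded continuous_on_iff, rule_format, of \<tau> "\<bar>X \<tau> \<omega> - z\<bar>"] T(2) by auto
  \<comment> \<open>Halving keeps \<open>\<tau> - e\<close> positive and the hit within
    \<open>d\<close> of \<tau>.\<close>
  define e where "e = min d \<tau> / 2"
  have e: "0 < e" "e < d" "e < \<tau>" using d(1) T(2) by (auto simp: e_def)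
  have "ennreal (\<tau> - e) < last_passage_time X z \<omega>"
    unfolding T(1) using e by (simp add: ennreal_less_iff)
  then obtain s where s: "\<tau> - e < s" "X s \<omega> = z"
    using last_passage_time_gt_iff[of "\<tau> - e" X z \<omega>] e by auto
  have "\<not> \<tau> < s"
  proof
    assume "\<tau> < s"
    then have "ennreal \<tau> < last_passage_time X z \<omega>"
      using last_passage_time_gt_iff[of \<tau> X z \<omega>] T(2) s(2) by auto
    then show False by (simp add: T(1))
  qed
  then have "dist (X s \<omega>) (X \<tau> \<omega>) < \<bar>X \<tau> \<omega> - z\<bar>"
    using s e by (intro d(2)) (auto simp: dist_real_def)
  then show False using s(2) by (simp add: dist_real_def)
qed

lemma stopped_process_before:
  assumes "0 \<le> s" "s \<le> t" "ennreal t < T \<omega>"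
  shows "stopped_process X T s \<omega> = X s \<omega>"
proof -
  have "ennreal s \<le> ennreal t" using assms by (simp add: ennreal_leI)
  also have "\<dots> \<le> T \<omega>" using assms(3) by (rule less_imp_le)
  finally have "ennreal s \<le> T \<omega>" .
  then show ?thesis using assms(1) by (simp add: stopped_process_def min_absorb1)
qed

lemma stopped_process_after:
  assumes "T \<omega> \<le> ennreal t"
  shows "stopped_process X T t \<omega> = X (enn2real (T \<omega>)) \<omega>"
  using assms by (simp add: stopped_process_def min_absorb2)

section \<open>Almost sure behaviour and measurability of the stopped process\<close>

locale last_passage_bridge = complete_brownian_motion M B for M :: "'a measure" and B +
  fixes lam z :: real
  assumes lam: "lam > 0" and z: "z > 0"
begin

abbreviation "X \<equiv> drifted B lam"
abbreviation "T \<equiv> last_passage_time X z"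
abbreviation "\<xi> \<equiv> last_passage_stopped_bm B lam z"
abbreviation "\<F>\<xi> \<equiv> completed_natural_filtration M \<xi>"

lemma continuous_X: "AE \<omega> in M. continuous_on {0..} (\<lambda>t. X t \<omega>)"
  using continuous_B by eventually_elim (auto simp: drifted_def intro!: continuous_intros)

lemma measurable_X[measurable]: "0 \<le> t \<Longrightarrow> X t \<in> borel_measurable M"
  unfolding drifted_def by measurable

text \<open>At time 0 the value is 0, below \<open>z\<close>; at positive times the law has a
  density and charges no point.\<close>

lemma X_neq:
  assumes "0 \<le> t"
  shows "AE \<omega> in M. X t \<omega> \<noteq> z"
proof (cases "t = 0")
  case True
  show ?thesis using B_0 by eventually_elim (use z True in \<open>simp add: drifted_def\<close>)
next
  case False
  then have D: "distributed M lborel (\<lambda>\<omega>. B t \<omega> - B 0 \<omega>) (normal_density 0 (sqrt (t - 0)))"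
    using assms by (intro distributed_increment) auto
  have "AE \<omega> in M. B t \<omega> - B 0 \<omega> \<noteq> z - lam * t"
    by (subst distributed_AE2[OF D]) (use AE_lborel_singleton[of "z - lam * t"] in auto)
  then show ?thesis
    using B_0 by eventually_elim (auto simp: drifted_def)
qed

text \<open>This excludes the default value 0 for paths that never reach \<open>z\<close>, where the
  process would be frozen at its start. Chebyshev's inequality shows that the drift lifts the path
  to \<open>z\<close> at some integer time; the intermediate value theorem gives the hit.\<close>

lemma T_pos: "AE \<omega> in M. 0 < T \<omega>"
proof -
  define D where "D n \<omega> = B (real n) \<omega> - B 0 \<omega>" for n \<omega>
  define E where "E = {\<omega>\<in>space M. \<forall>n>0. D n \<omega> < z - lam * real n}"
  have [measurable]: "D n \<in> borel_measurable M" for n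
    unfolding D_def by measurable
  have [measurable]: "E \<in> events" unfolding E_def by measurable
  \<comment> \<open>For such \<open>n\<close>, staying below \<open>z\<close> forces a deviation of
    at least \<open>lam * real n / 2\<close>; the bound is the variance \<open>real n\<close> over
    its square.\<close>
  have bound: "prob E \<le> (4 / lam\<^sup>2) / real n" if n: "n > 0" "real n \<ge> 2 * z / lam" for n
  proof -
    have dist: "distributed M lborel (D n) (normal_density 0 (sqrt (real n)))"
      using distributed_increment[of 0 "real n"] n by (simp add: D_def[abs_def])
    have sq: "0 < sqrt (real n)" using n by simp
    have ex: "expectation (D n) = 0" and var: "variance (D n) = real n"
      using normal_distributed_expectation[OF sq dist] normal_distributed_variance[OF sq dist] by auto
    have "integrable lborel (\<lambda>x. normal_density 0 (sqrt (real n)) x * (x - 0)^2)"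
      by (rule integrable_normal_moment[OF sq])
    then have int: "integrable M (\<lambda>\<omega>. D n \<omega> ^ 2)"
      using distributed_integrable[OF dist, of "\<lambda>x. x^2"] by simp
    have "2 * z \<le> lam * real n" using n lam by (simp add: field_simps)
    then have half: "z - lam * real n \<le> - (lam * real n / 2)" by linarith
    have "E \<subseteq> {\<omega>\<in>space M. lam * real n / 2 \<le> \<bar>D n \<omega> - expectation (D n)\<bar>}"
    proof
      fix \<omega> assume "\<omega> \<in> E"
      then have "\<omega> \<in> space M" "D n \<omega> < z - lam * real n" using n by (auto simp: E_def)
      then show "\<omega> \<in> {\<omega>\<in>space M. lam * real n / 2 \<le> \<bar>D n \<omega> - expectation (D n)\<bar>}"
        using half unfolding ex by simp
    qed
    then have "prob E \<le> prob {\<omega>\<in>space M. lam * real n / 2 \<le> \<bar>D n \<omega> - expectation (D n)\<bar>}"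
      by (intro finite_measure_mono) measurable
    also have "\<dots> \<le> variance (D n) / (lam * real n / 2)\<^sup>2"
      by (rule Chebyshev_inequality) (use int lam n in auto)
    also have "\<dots> = (4 / lam\<^sup>2) / real n"
      unfolding var using n lam by (simp add: field_simps power2_eq_square)
    finally show ?thesis .
  qed
  have "(\<lambda>n. (4 / lam\<^sup>2) / real n) \<longlonglongrightarrow> 0" by (rule lim_const_over_n)
  moreover have "\<forall>\<^sub>F n in sequentially. prob E \<le> (4 / lam\<^sup>2) / real n"
    using eventually_gt_at_top[of 0] eventually_ge_at_top[of "nat \<lceil>2 * z / lam\<rceil>"]
    by eventually_elim (rule bound, auto simp: nat_le_iff ceiling_le_iff)
  ultimately have "prob E \<le> 0"
    by (intro tendsto_lowerbound[of _ 0 sequentially]) auto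
  then have "prob E = 0" by (simp add: measure_le_0_iff)
  then have "AE \<omega> in M. \<omega> \<notin> E" by (intro AE_not_in) (auto simp: null_sets_def emeasure_eq_measure)
  then show ?thesis
    using B_0 continuous_X AE_space
  proof eventually_elim
    case (elim \<omega>)
    then obtain n :: nat where n: "n > 0" "D n \<omega> \<ge> z - lam * real n" by (auto simp: E_def not_less)
    then have "z \<le> X (real n) \<omega>" "X 0 \<omega> \<le> z" using elim z by (auto simp: D_def drifted_def)
    moreover have "continuous_on {0..real n} (\<lambda>t. X t \<omega>)"
      using elim(3) by (rule continuous_on_subset) auto
    ultimately obtain s where s: "0 \<le> s" "X s \<omega> = z"
      using IVT'[of "\<lambda>t. X t \<omega>" 0 z "real n"] by auto
    moreover have "s \<noteq> 0" using s elim z by (auto simp: drifted_def)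
    ultimately show "0 < T \<omega>"
      using last_passage_time_gt_iff[of 0 X z \<omega>] by (auto intro!: exI[of _ s])
  qed
qed

lemma \<xi>_before: "0 \<le> s \<Longrightarrow> s \<le> t \<Longrightarrow> ennreal t < T \<omega> \<Longrightarrow> \<xi> s \<omega> = X s \<omega>"
  unfolding last_passage_stopped_bm_def by (rule stopped_process_before[where T = T and \<omega> = \<omega>])

text \<open>On \<open>T \<omega> \<le> ennreal t\<close> the passage time is finite and positive, so
  the stopped value is the level itself. One null set serves all \<open>t\<close>.\<close>

lemma \<xi>_after: "AE \<omega> in M. \<forall>t. T \<omega> \<le> ennreal t \<longrightarrow> \<xi> t \<omega> = z"
  using T_pos continuous_X
proof eventually_elim
  case (elim \<omega>)
  show ?case
  proof (intro allI impI)
    fix t assume le: "T \<omega> \<le> ennreal t"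
    then have "T \<omega> \<noteq> \<top>" using ennreal_less_top[of t] by (auto simp: top_unique)
    then have "T \<omega> = ennreal (enn2real (T \<omega>))" "0 < enn2real (T \<omega>)"
      using elim by (auto simp: enn2real_positive_iff less_top)
    then have "X (enn2real (T \<omega>)) \<omega> = z" by (rule at_last_passage_time[where X = X and \<omega> = \<omega>, OF elim(2)])
    then show "\<xi> t \<omega> = z"
      unfolding last_passage_stopped_bm_def by (simp add: stopped_process_after[where T = T and \<omega> = \<omega>, OF le])
  qed
qed

text \<open>Before the last passage \<open>\<xi> t\<close> equals \<open>X t\<close>, which almost
  surely differs from \<open>z\<close>; afterwards it is \<open>z\<close>. So the present value
  reveals whether the passage has occurred.\<close>

lemma T_gt_iff:
  assumes t: "0 \<le> t"
  shows "AE \<omega> in M. ennreal t < T \<omega> \<longleftrightarrow> \<xi> t \<omega> \<noteq> z"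
  using \<xi>_after X_neq[OF t]
proof eventually_elim
  case (elim \<omega>)
  then show ?case
    using \<xi>_before[OF t order_refl, of \<omega>] by (cases "ennreal t < T \<omega>") (auto simp: not_less)
qed

text \<open>On continuous paths the event is the countable combination \<open>G\<close> of events at
  rational times; completeness absorbs the remaining paths.\<close>

lemma T_gt_event:
  assumes t: "0 \<le> t"
  shows "{\<omega>\<in>space M. ennreal t < T \<omega>} \<in> events"
proof -
  let ?Q = "\<lambda>N::nat. \<rat> \<inter> {t + 1 / real (Suc N)..t + real (Suc N)}"
  define G where "G = (\<Union>N. \<Inter>k. \<Union>q\<in>?Q N. {\<omega>\<in>space M. \<bar>X q \<omega> - z\<bar> < 1 / real (Suc k)})"
  have meas: "{\<omega>\<in>space M. \<bar>X q \<omega> - z\<bar> < 1 / real (Suc k)} \<in> events" if "q \<in> ?Q N" for q k N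
  proof -
    have "0 \<le> 1 / real (Suc N)" by simp
    moreover have "t + 1 / real (Suc N) \<le> q" using that by simp
    ultimately have "0 \<le> q" using t by linarith
    then show ?thesis by measurable
  qed
  have "countable (?Q N)" for N using countable_rat by (rule countable_Int1)
  then have "(\<Union>q\<in>?Q N. {\<omega>\<in>space M. \<bar>X q \<omega> - z\<bar> < 1 / real (Suc k)}) \<in> events" for N k
    using meas by (rule sets.countable_UN'')
  then have G: "G \<in> events" unfolding G_def by (intro sets.countable_UN sets.countable_INT image_subsetI) auto
  have "AE \<omega> in M. \<omega> \<in> G \<longleftrightarrow> \<omega> \<in> {\<omega>\<in>space M. ennreal t < T \<omega>}"
    using continuous_X AE_space
  proof eventually_elim
    case (elim \<omega>)
    show ?case
      using elim(2) unfolding G_def last_passage_time_gt_iff[OF t]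
        hit_iff_rational_approximation[OF elim(1) t] mem_Collect_eq by simp
  qed
  then show ?thesis using G by (rule in_sets_AE) auto
qed

text \<open>The evaluation at a random time is replaced, off a null set, by a case distinction on
  the last passage.\<close>

lemma measurable_\<xi>:
  assumes t: "0 \<le> t"
  shows "\<xi> t \<in> borel_measurable M"
proof (rule measurable_subalgebra_AE)
  show "(\<lambda>\<omega>. if ennreal t < T \<omega> then X t \<omega> else z) \<in> borel_measurable M"
    using T_gt_event[OF t] measurable_X[OF t] by (intro measurable_If) auto
  show "AE \<omega> in M. (if ennreal t < T \<omega> then X t \<omega> else z) = \<xi> t \<omega>"
    using \<xi>_after
  proof eventually_elim
    case (elim \<omega>)
    then show ?case
      using \<xi>_before[OF t order_refl, of \<omega>] by (auto simp: not_less)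
  qed
qed (simp_all add: subalgebra_def null_sets_def subset_iff)

lemma subalgebra_\<F>\<xi>: "subalgebra M (\<F>\<xi> t)"
  by (rule subalgebra_completed_natural_filtration) (rule measurable_\<xi>)

text \<open>\<open>H\<close> is represented separately after and before the last passage, by
  \<open>h1\<close> and \<open>h2\<close>, and the two are glued along an event observable at time
  \<open>t\<close>.\<close>

lemma stopped_filtration_right_continuous:
  assumes t: "0 \<le> t" and H: "\<And>u. t < u \<Longrightarrow> H \<in> sets (\<F>\<xi> u)"
  shows "H \<in> sets (\<F>\<xi> t)"
proof -
  define r where "r n = t + 1 / real (Suc n)" for n
  have r: "t < r n" "0 \<le> r n" for n using t by (simp_all add: r_def add_nonneg_nonneg)
  have r_anti: "r n \<le> r m" if "m \<le> n" for m n using that by (simp add: r_def frac_le)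
  have r_lim: "r \<longlonglongrightarrow> t"
    unfolding r_def using tendsto_add[OF tendsto_const LIMSEQ_inverse_real_of_nat, of t]
    by (simp add: inverse_eq_divide)
  have m\<xi>: "\<xi> s \<in> borel_measurable (\<F>\<xi> t)" if "0 \<le> s" "s \<le> t" for s
    using that by (rule measurable_completed_natural_filtration)
  \<comment> \<open>Once the passage has occurred, values after \<open>t\<close> are the constant
    \<open>z\<close> and add nothing.\<close>
  have "\<exists>h\<in>sets (\<F>\<xi> t). AE \<omega> in M. T \<omega> \<le> ennreal t \<longrightarrow> (\<omega> \<in> H \<longleftrightarrow> \<omega> \<in> h)"
  proof (rule completed_natural_filtration_AE_trace[OF H[of "t + 1"]])
    fix s :: real assume s: "0 \<le> s"
    show "\<exists>Y\<in>borel_measurable (\<F>\<xi> t). AE \<omega> in M. T \<omega> \<le> ennreal t \<longrightarrow> \<xi> s \<omega> = Y \<omega>"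
    proof (cases "s \<le> t")
      case True
      then show ?thesis using m\<xi>[OF s] by (intro bexI[of _ "\<xi> s"]) auto
    next
      case False
      have "AE \<omega> in M. T \<omega> \<le> ennreal t \<longrightarrow> \<xi> s \<omega> = z"
        using \<xi>_after
      proof eventually_elim
        case (elim \<omega>)
        have "ennreal t \<le> ennreal s" using False by (intro ennreal_leI) simp
        then show ?case using elim by (auto dest: order_trans)
      qed
      then show ?thesis by (intro bexI[of _ "\<lambda>_. z"]) auto
    qed
  qed auto
  then obtain h1 where h1: "h1 \<in> sets (\<F>\<xi> t)"
    "AE \<omega> in M. T \<omega> \<le> ennreal t \<longrightarrow> (\<omega> \<in> H \<longleftrightarrow> \<omega> \<in> h1)" by blast
  \<comment> \<open>Before the passage the stopped process is still the drifted motion, so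
    \<open>H\<close> has a Brownian representative \<open>A n\<close> there.\<close>
  have "\<exists>h\<in>sets (\<F> (r n)). AE \<omega> in M. ennreal (r n) < T \<omega> \<longrightarrow> (\<omega> \<in> H \<longleftrightarrow> \<omega> \<in> h)" for n
  proof (rule completed_natural_filtration_AE_trace[OF H[OF r(1)]])
    fix s assume s: "0 \<le> s" "s \<le> r n"
    have "X s \<in> borel_measurable (\<F> (r n))"
      unfolding drifted_def
      using measurable_completed_natural_filtration[OF s, where X = B and M = M] by measurable
    then show "\<exists>Y\<in>borel_measurable (\<F> (r n)). AE \<omega> in M. ennreal (r n) < T \<omega> \<longrightarrow> \<xi> s \<omega> = Y \<omega>"
      by (intro bexI[of _ "X s"]) (use s in \<open>auto simp: \<xi>_before\<close>)
  qed simp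
  then obtain A where A: "\<And>n. A n \<in> sets (\<F> (r n))"
    and A_H: "\<And>n. AE \<omega> in M. ennreal (r n) < T \<omega> \<longrightarrow> (\<omega> \<in> H \<longleftrightarrow> \<omega> \<in> A n)" by metis
  \<comment> \<open>The limit superior does not depend on finitely many \<open>A n\<close>, so it
    lies in \<open>\<F> u\<close> for every \<open>u\<close> after \<open>t\<close>; Brownian
    right-continuity then places it in \<open>\<F> t\<close>.\<close>
  define L where "L = (\<Inter>m. \<Union>n\<in>{m..}. A n)"
  have L_tail: "L = (\<Inter>m\<in>{k..}. \<Union>n\<in>{m..}. A n)" for k
    unfolding L_def
  proof (intro equalityI subsetI INT_I)
    fix x m assume "x \<in> (\<Inter>m\<in>{k..}. \<Union>n\<in>{m..}. A n)"
    then have "x \<in> (\<Union>n\<in>{max k m..}. A n)" by simp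
    then show "x \<in> (\<Union>n\<in>{m..}. A n)" by auto
  qed auto
  have "L \<in> sets (\<F> t)"
  proof (rule brownian_filtration_right_continuous[OF t])
    fix u assume "t < u"
    then obtain k where k: "\<And>n. n \<ge> k \<Longrightarrow> r n < u"
      using order_tendstoD(2)[OF r_lim, of u] by (auto simp: eventually_sequentially)
    have "A n \<in> sets (\<F> u)" if "n \<ge> k" for n
      using A[of n] completed_natural_filtration_mono[of "r n" u M B] k[OF that] by auto
    then have "(\<Union>n\<in>{m..}. A n) \<in> sets (\<F> u)" if "m \<ge> k" for m
      using that by (intro sets.countable_UN') auto
    then show "L \<in> sets (\<F> u)"
      unfolding L_tail[of k] by (intro sets.countable_INT') auto
  qed
  \<comment> \<open>The way back: before the passage, subtracting the drift from the stopped process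
    recovers \<open>B\<close> up to \<open>t\<close>.\<close>
  have "\<exists>h\<in>sets (\<F>\<xi> t). AE \<omega> in M. ennreal t < T \<omega> \<longrightarrow> (\<omega> \<in> L \<longleftrightarrow> \<omega> \<in> h)"
  proof (rule completed_natural_filtration_AE_trace[OF \<open>L \<in> sets (\<F> t)\<close>])
    fix s assume s: "0 \<le> s" "s \<le> t"
    have "(\<lambda>\<omega>. \<xi> s \<omega> - lam * s) \<in> borel_measurable (\<F>\<xi> t)"
      using m\<xi>[OF s] by measurable
    moreover have "AE \<omega> in M. ennreal t < T \<omega> \<longrightarrow> B s \<omega> = \<xi> s \<omega> - lam * s"
      using s by (auto simp: \<xi>_before drifted_def)
    ultimately show "\<exists>Y\<in>borel_measurable (\<F>\<xi> t). AE \<omega> in M. ennreal t < T \<omega> \<longrightarrow> B s \<omega> = Y \<omega>"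
      by (intro bexI[of _ "\<lambda>\<omega>. \<xi> s \<omega> - lam * s"])
  qed simp
  then obtain h2 where h2: "h2 \<in> sets (\<F>\<xi> t)"
    "AE \<omega> in M. ennreal t < T \<omega> \<longrightarrow> (\<omega> \<in> L \<longleftrightarrow> \<omega> \<in> h2)" by blast
  have A_H': "AE \<omega> in M. \<forall>n. ennreal (r n) < T \<omega> \<longrightarrow> (\<omega> \<in> H \<longleftrightarrow> \<omega> \<in> A n)"
    using A_H by (subst AE_all_countable) blast
  \<comment> \<open>If the passage is later than \<open>t\<close>, it is later than
    \<open>r n\<close> for all large \<open>n\<close>, and from then on \<open>A n\<close> agrees
    with \<open>H\<close>.\<close>
  have L_H: "AE \<omega> in M. ennreal t < T \<omega> \<longrightarrow> (\<omega> \<in> H \<longleftrightarrow> \<omega> \<in> L)"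
    using A_H'
  proof eventually_elim
    case (elim \<omega>)
    show ?case
    proof
      assume "ennreal t < T \<omega>"
      moreover have "(\<lambda>n. ennreal (r n)) \<longlonglongrightarrow> ennreal t" using r_lim by (rule tendsto_ennrealI)
      ultimately obtain k where k: "\<And>n. n \<ge> k \<Longrightarrow> ennreal (r n) < T \<omega>"
        using order_tendstoD(2)[of _ "ennreal t" sequentially "T \<omega>"] by (auto simp: eventually_sequentially)
      then have "\<omega> \<in> A n \<longleftrightarrow> \<omega> \<in> H" if "n \<ge> k" for n using elim that by blast
      then show "\<omega> \<in> H \<longleftrightarrow> \<omega> \<in> L" unfolding L_tail[of k] by force
    qed
  qed
  \<comment> \<open>By \<open>T_gt_iff\<close> this is a version, observable at time
    \<open>t\<close>, of the event that the passage is still to come.\<close>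
  define W where "W = \<xi> t -` (- {z}) \<inter> space (\<F>\<xi> t)"
  have W: "W \<in> sets (\<F>\<xi> t)" unfolding W_def by (rule measurable_sets[OF m\<xi>]) (use t in auto)
  have "AE \<omega> in M. \<omega> \<in> H \<longleftrightarrow> \<omega> \<in> (h1 - W) \<union> (h2 \<inter> W)"
    using h1(2) h2(2) L_H T_gt_iff[OF t] AE_space
    by eventually_elim (auto simp: W_def not_less)
  moreover have "(h1 - W) \<union> (h2 \<inter> W) \<in> sets (\<F>\<xi> t)" using h1(1) h2(1) W by blast
  moreover have "H \<subseteq> space M"
    using sets.sets_into_space[OF H[of "t + 1"]] by simp
  ultimately show ?thesis
    by (rule in_subalgebra_AE[OF subalgebra_\<F>\<xi> null_sets_completed_natural_filtration])
qed

end

theorem corollary2p3: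
  fixes M :: "'a measure" and B :: "real \<Rightarrow> 'a \<Rightarrow> real" and lam z :: real
  assumes "prob_space M" and "complete_measure M"
    and "standard_brownian_motion M B"
    and "lam > 0" and "z > 0"
  shows "usual_conditions M (completed_natural_filtration M (last_passage_stopped_bm B lam z))"
proof -
  interpret prob_space M by fact
  interpret complete_measure M by fact
  interpret last_passage_bridge M B lam z by standard fact+
  have "sets (\<F>\<xi> t) = (\<Inter>u\<in>{t<..}. sets (\<F>\<xi> u))" if "0 \<le> t" for t
  proof (rule antisym)
    show "sets (\<F>\<xi> t) \<subseteq> (\<Inter>u\<in>{t<..}. sets (\<F>\<xi> u))"
      by (intro INT_greatest completed_natural_filtration_mono) simp
    show "(\<Inter>u\<in>{t<..}. sets (\<F>\<xi> u)) \<subseteq> sets (\<F>\<xi> t)"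
      using stopped_filtration_right_continuous[OF that] by auto
  qed
  moreover have "filtration_on M \<F>\<xi>"
    unfolding filtration_on_def using subalgebra_\<F>\<xi> completed_natural_filtration_mono by blast
  moreover have "complete_filtration M \<F>\<xi>"
    unfolding complete_filtration_def using assms(2) null_sets_completed_natural_filtration by blast
  ultimately show ?thesis
    unfolding usual_conditions_def right_continuous_filtration_def by blast
qed

end
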